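(* Let $\Gamma$ be a junction, let the data $\lambda>0$, $(H_i)$, $(\nu_{ij})$, $(h_i)$ satisfy the standing assumptions listed in the context (including convexity of the Hamiltonians), and let $B\in\mathbb{R}$. Then every viscosity flux-limited (FL) subsolution (resp. FL supersolution), for the flux limiter $FL^-$ associated with $B$, is a viscosity subsolution (resp. supersolution) of the Kirchhoff problem $$\lambda u(x)-\mathcal{I}_iu(x)+H_i(x,u_{x_i}(x))=0\ \ (x\in E_i,\ 1\le i\le N),\qquad \sum_{i=1}^N-u_{x_i}(O)=B,\qquad u_i(a_i)=h_i\ \ (1\le i\le N).$$
   Context: **Junction.** Let $d\ge 2$, $N\ge1$, $O=0\in\mathbb{R}^d$, and let $\mathbf{v}_1,\dots,\mathbf{v}_N\in\mathbb{R}^d\setminus\{O\}$ be pairwise non-collinear. Set $E_i=\{t\mathbf{v}_i: t\in(0,1)\}$, $a_i=|\mathbf{v}_i|$, $J_i=(0,a_i)$, $\Gamma=\bigcup_{i=1}^N\bar E_i$, $\gamma_i:[0,a_i]\to\bar E_i$, $\gamma_i(s)=s\,\mathbf{v}_i/a_i$, $x_i=|x|$ for $x\in\bar E_i$. $\rho(x,y)=|x-y|$ if $x,y$ lie in the same $\bar E_i$ and $\rho(x,y)=|x|+|y|$ otherwise. $B_\delta(x)=\{z\in\Gamma:\rho(x,z)<\delta\}$, $B_\delta^c(x)=\Gamma\setminus B_\delta(x)$. **Function spaces.** $u_i=u\circ\gamma_i$. $USC(\Gamma)$ (resp. $LSC(\Gamma)$): all $u_i$ upper (resp. lower) semicontinuous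 on $[0,a_i]$; $C(\Gamma)=USC(\Gamma)\cap LSC(\Gamma)$; $C^1(\Gamma)=\{u\in C(\Gamma):u_i\in C^1([0,a_i])\ \forall i\}$; $u_{x_i}(x)=u_i'(x_i)$ for $x\in\bar E_i$. **Standing assumptions.** $\lambda>0$; $B,h_i\in\mathbb{R}$. $H_i\in C(\bar E_i\times\mathbb{R})$ and there is $C_H>1$ with, for all $i$, $x,y\in\bar E_i$, $p,q\in\mathbb{R}$: $|H_i(x,p)-H_i(y,p)|\le C_H(1+|p|)|x-y|$; $|H_i(x,p)-H_i(x,q)|\le C_H|p-q|$; $C_H^{-1}|p|-C_H\le H_i(x,p)\le C_H(1+|p|)$. Moreover each $p\mapsto H_i(x,p)$ is convex with a unique minimum point $p_i^0(x)$. The $\nu_{ij}:\bar E_i\times(0,\infty)\to[0,\infty)$ are measurable and there are $\Lambda>0$, $\sigma\in(0,1)$ with $0\le\nu_{ij}(x,r)\le\Lambda r^{-1-\sigma}$, $|\nu_{ij}(x,r)-\nu_{ij}(y,r)|\le\Lambda r^{-1-\sigma}|x-y|$ for all $i,j$, $x,y\in\bar E_i$, $r>0$. **Operators.** For measurable $A\subseteq\Gamma$, $x\in\bar E_i$: $\mathcal{I}_i[A]\varphi(x)=\sum_{j=1}^N\int_{\{z\in J_j:\gamma_j(z)\in A\}}[\varphi_j(z)-\varphi(x)]\,\nu_{ij}(x,\rho(x,\gamma_j(z)))\,dz$, $\mathcal{I}_i=\mathcal{I}_i[\Gamma]$. $H_i^-(x,p)=H_i(x,p_i^0(x))$ if $p\le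 p_i^0(x)$ and $=H_i(x,p)$ if $p\ge p_i^0(x)$ (nondecreasing part); $H_i^+(x,p)=H_i(x,p)$ if $p\le p_i^0(x)$ and $=H_i(x,p_i^0(x))$ if $p\ge p_i^0(x)$ (nonincreasing part). Set $G_i^\delta(u,\varphi,p,x)=\lambda u(x)-\mathcal{I}_i[B_\delta^c(x)]u(x)-\mathcal{I}_i[B_\delta(x)]\varphi(x)+H_i(x,p)$, and $G_i^{\pm,\delta}(u,\varphi,p,x)=\lambda u(x)-\mathcal{I}_i[B_\delta^c(x)]u(x)-\mathcal{I}_i[B_\delta(x)]\varphi(x)+H_i^\pm(x,p)$. **Flux limiter.** $FL^{-,\delta}(u,\varphi,O)=\min_{p_1,\dots,p_N\in\mathbb{R}}\max\{\max_{1\le i\le N}G_i^{-,\delta}(u,\varphi,p_i,O),\ \sum_{i=1}^N-p_i-B\}$. (The operator $FL^-$ is its limiting version, where $G_i^{-,\delta}$ is replaced by $\lambda u(O)-\mathcal{I}_iu(O)+H_i^-(O,p_i)$.) **Viscosity solutions of the Kirchhoff problem.** $u\in USC(\Gamma)$ is a viscosity subsolution if for all $x\in\Gamma$, $\delta>0$, $\varphi\in C^1(\Gamma)$ such that $x$ is a maximum point of $u-\varphi$ in $B_\delta(x)$: $G_i^\delta(u,\varphi,\varphi_{x_i}(x),x)\le0$ if $x\in E_i$; $\min\{\min_iG_i^\delta(u,\varphi,\varphi_{x_i}(O),O),\ \sum_i-\varphi_{x_i}(O)-B\}\le0$ if $x=O$; $\min\{G_i^\delta(u,\varphi,\varphi_{x_i}(x),x),\,u(x)-h_i\}\le0$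 if $x=\mathbf{v}_i$. $u\in LSC(\Gamma)$ is a viscosity supersolution if for all $x\in\Gamma$, $\delta>0$, $\varphi\in C^1(\Gamma)$ such that $x$ is a minimum point of $u-\varphi$ in $B_\delta(x)$: $G_i^\delta(u,\varphi,\varphi_{x_i}(x),x)\ge0$ if $x\in E_i$; $\max\{\max_iG_i^\delta(u,\varphi,\varphi_{x_i}(O),O),\ \sum_i-\varphi_{x_i}(O)-B\}\ge0$ if $x=O$; $\max\{G_i^\delta(u,\varphi,\varphi_{x_i}(x),x),\,u(x)-h_i\}\ge0$ if $x=\mathbf{v}_i$. **FL viscosity solutions.** $u\in USC(\Gamma)$ is a viscosity FL subsolution if for all $x\in\Gamma$, $\delta>0$, $\varphi\in C^1(\Gamma)$ such that $x$ is a maximum point of $u-\varphi$ in $B_\delta(x)$: $G_i^\delta(u,\varphi,\varphi_{x_i}(x),x)\le0$ if $x\in E_i$; $\max\{\max_iG_i^{+,\delta}(u,\varphi,\varphi_{x_i}(O),O),\ FL^{-,\delta}(u,\varphi,O)\}\le0$ if $x=O$; $\min\{G_i^\delta(u,\varphi,\varphi_{x_i}(x),x),\,u(x)-h_i\}\le0$ if $x=\mathbf{v}_i$. $u\in LSC(\Gamma)$ is a viscosity FL supersolution if for all $x\in\Gamma$, $\delta>0$, $\varphi\in C^1(\Gamma)$ such that $x$ is a minimum point of $u-\varphi$ in $B_\delta(x)$: $G_i^\delta(u,\varphi,\varphi_{x_i}(x),x)\ge0$ if $x\in E_i$; $\max\{\max_iG_i^{+,\delta}(u,\varphi,\varphi_{x_i}(O),O),\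 FL^{-,\delta}(u,\varphi,O)\}\ge0$ if $x=O$; $\max\{G_i^\delta(u,\varphi,\varphi_{x_i}(x),x),\,u(x)-h_i\}\ge0$ if $x=\mathbf{v}_i$. *)

theory Defs
  imports "HOL-Analysis.Analysis"
begin

section \<open>Junctions\<close>

text \<open>
  The edges are indexed by a finite type \<open>'n\<close> (so \<open>N = CARD('n) \<ge> 1\<close>), and the ambient space is
  \<open>real ^ 'd\<close>. Functions on the junction are represented by total functions on \<open>real ^ 'd\<close>;
  only their values on the junction are ever used.
\<close>

definition is_junction :: "('n::finite \<Rightarrow> real ^ 'd) \<Rightarrow> bool" where
  "is_junction v \<longleftrightarrow>
     CARD('d) \<ge> 2 \<and> (\<forall>i. v i \<noteq> 0) \<and> (\<forall>i j. i \<noteq> j \<longrightarrow> \<not> collinear {0, v i, v j})"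

definition edge :: "('n::finite \<Rightarrow> real ^ 'd) \<Rightarrow> 'n \<Rightarrow> (real ^ 'd) set" where
  "edge v i = {t *\<^sub>R v i | t. t \<in> {0<..<1}}"

definition junction :: "('n::finite \<Rightarrow> real ^ 'd) \<Rightarrow> (real ^ 'd) set" where
  "junction v = (\<Union>i. closure (edge v i))"

definition edge_param :: "('n::finite \<Rightarrow> real ^ 'd) \<Rightarrow> 'n \<Rightarrow> real \<Rightarrow> real ^ 'd" where
  "edge_param v i s = (s / norm (v i)) *\<^sub>R v i"

definition jdist :: "('n::finite \<Rightarrow> real ^ 'd) \<Rightarrow> real ^ 'd \<Rightarrow> real ^ 'd \<Rightarrow> real" where
  "jdist v x y =
     (if \<exists>i. x \<in> closure (edge v i) \<and> y \<in> closure (edge v i) then norm (x - y)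
      else norm x + norm y)"

definition jball :: "('n::finite \<Rightarrow> real ^ 'd) \<Rightarrow> real \<Rightarrow> real ^ 'd \<Rightarrow> (real ^ 'd) set" where
  "jball v \<delta> x = {z \<in> junction v. jdist v x z < \<delta>}"

definition jball_compl :: "('n::finite \<Rightarrow> real ^ 'd) \<Rightarrow> real \<Rightarrow> real ^ 'd \<Rightarrow> (real ^ 'd) set" where
  "jball_compl v \<delta> x = junction v - jball v \<delta> x"


section \<open>Function spaces\<close>

definition usc_on :: "real set \<Rightarrow> (real \<Rightarrow> real) \<Rightarrow> bool" where
  "usc_on S f \<longleftrightarrow> (\<forall>s\<in>S. \<forall>c > f s. \<forall>\<^sub>F t in at s within S. f t < c)"

definition lsc_on :: "real set \<Rightarrow> (real \<Rightarrow> real) \<Rightarrow> bool" where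
  "lsc_on S f \<longleftrightarrow> (\<forall>s\<in>S. \<forall>c < f s. \<forall>\<^sub>F t in at s within S. c < f t)"

definition USC :: "('n::finite \<Rightarrow> real ^ 'd) \<Rightarrow> (real ^ 'd \<Rightarrow> real) set" where
  "USC v = {u. \<forall>i. usc_on {0..norm (v i)} (u \<circ> edge_param v i)}"

definition LSC :: "('n::finite \<Rightarrow> real ^ 'd) \<Rightarrow> (real ^ 'd \<Rightarrow> real) set" where
  "LSC v = {u. \<forall>i. lsc_on {0..norm (v i)} (u \<circ> edge_param v i)}"

text \<open>
  Derivatives at the end points of an edge are one-sided, so the library's
  \<open>C1_differentiable_on\<close>, which uses the two-sided derivative, is not used here.
\<close>

definition C1_on :: "real set \<Rightarrow> (real \<Rightarrow> real) \<Rightarrow> bool" where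
  "C1_on S f \<longleftrightarrow>
     (\<exists>f'. (\<forall>s\<in>S. (f has_vector_derivative f' s) (at s within S)) \<and> continuous_on S f')"

definition C1 :: "('n::finite \<Rightarrow> real ^ 'd) \<Rightarrow> (real ^ 'd \<Rightarrow> real) set" where
  "C1 v = {u \<in> USC v \<inter> LSC v. \<forall>i. C1_on {0..norm (v i)} (u \<circ> edge_param v i)}"

definition edge_deriv ::
  "('n::finite \<Rightarrow> real ^ 'd) \<Rightarrow> 'n \<Rightarrow> (real ^ 'd \<Rightarrow> real) \<Rightarrow> real ^ 'd \<Rightarrow> real" where
  "edge_deriv v i u x =
     vector_derivative (u \<circ> edge_param v i) (at (norm x) within {0..norm (v i)})"


section \<open>Data\<close>

definition is_min_point :: "(real \<Rightarrow> real) \<Rightarrow> real \<Rightarrow> bool" where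
  "is_min_point f p \<longleftrightarrow> (\<forall>q. f p \<le> f q)"

definition hamiltonians ::
  "('n::finite \<Rightarrow> real ^ 'd) \<Rightarrow> ('n \<Rightarrow> real ^ 'd \<Rightarrow> real \<Rightarrow> real) \<Rightarrow> bool" where
  "hamiltonians v H \<longleftrightarrow>
     (\<forall>i. continuous_on (closure (edge v i) \<times> UNIV) (\<lambda>(x, p). H i x p)) \<and>
     (\<exists>C>1. \<forall>i. \<forall>x\<in>closure (edge v i). \<forall>y\<in>closure (edge v i). \<forall>p q.
        \<bar>H i x p - H i y p\<bar> \<le> C * (1 + \<bar>p\<bar>) * norm (x - y) \<and>
        \<bar>H i x p - H i x q\<bar> \<le> C * \<bar>p - q\<bar> \<and>
        inverse C * \<bar>p\<bar> - C \<le> H i x p \<and> H i x p \<le> C * (1 + \<bar>p\<bar>)) \<and>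
     (\<forall>i. \<forall>x\<in>closure (edge v i). convex_on UNIV (H i x) \<and> (\<exists>!p. is_min_point (H i x) p))"

text \<open>
  Measurability of the kernels is Lebesgue measurability in \<open>(s, r)\<close> with \<open>x = edge_param v i s\<close>.
  It follows from Borel measurability on \<open>closure (edge v i) \<times> {0<..}\<close>.
\<close>

definition kernels ::
  "('n::finite \<Rightarrow> real ^ 'd) \<Rightarrow> ('n \<Rightarrow> 'n \<Rightarrow> real ^ 'd \<Rightarrow> real \<Rightarrow> real) \<Rightarrow> bool" where
  "kernels v \<nu> \<longleftrightarrow>
     (\<forall>i j. (\<lambda>(s, r). \<nu> i j (edge_param v i s) r)
        \<in> borel_measurable (lebesgue_on ({0..norm (v i)} \<times> {0<..}))) \<and>
     (\<exists>\<Lambda>>0. \<exists>\<sigma>\<in>{0<..<1}. \<forall>i j. \<forall>x\<in>closure (edge v i). \<forall>y\<in>closure (edge v i). \<forall>r>0.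
        0 \<le> \<nu> i j x r \<and> \<nu> i j x r \<le> \<Lambda> * r powr (-1 - \<sigma>) \<and>
        \<bar>\<nu> i j x r - \<nu> i j y r\<bar> \<le> \<Lambda> * r powr (-1 - \<sigma>) * norm (x - y))"


section \<open>Operators\<close>

text \<open>
  The integrals are extended-real valued. A function in \<open>USC v\<close> is bounded above on the junction but
  possibly not below, so away from \<open>x\<close> the nonlocal term may be \<open>-\<infinity>\<close>; dually it may be \<open>\<infinity>\<close> on
  \<open>LSC v\<close>. The Bochner integral would give the value \<open>0\<close> in these cases. The indeterminate form
  \<open>\<infinity> - \<infinity>\<close> does not occur for the arguments considered below.
\<close>

definition ext_integral :: "real set \<Rightarrow> (real \<Rightarrow> real) \<Rightarrow> ereal" where
  "ext_integral S f =
     enn2ereal (\<integral>\<^sup>+ z\<in>S. ennreal (f z) \<partial>lebesgue) - enn2ereal (\<integral>\<^sup>+ z\<in>S. ennreal (- f z) \<partial>lebesgue)"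

definition nonlocal ::
  "('n::finite \<Rightarrow> real ^ 'd) \<Rightarrow> ('n \<Rightarrow> 'n \<Rightarrow> real ^ 'd \<Rightarrow> real \<Rightarrow> real) \<Rightarrow> 'n \<Rightarrow> (real ^ 'd) set \<Rightarrow>
   (real ^ 'd \<Rightarrow> real) \<Rightarrow> real ^ 'd \<Rightarrow> ereal" where
  "nonlocal v \<nu> i A \<phi> x =
     (\<Sum>j\<in>UNIV. ext_integral {z \<in> {0<..<norm (v j)}. edge_param v j z \<in> A}
        (\<lambda>z. (\<phi> (edge_param v j z) - \<phi> x) * \<nu> i j x (jdist v x (edge_param v j z))))"

definition min_point :: "('n \<Rightarrow> real ^ 'd \<Rightarrow> real \<Rightarrow> real) \<Rightarrow> 'n \<Rightarrow> real ^ 'd \<Rightarrow> real" where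
  "min_point H i x = (THE p. is_min_point (H i x) p)"

text \<open>\<open>H_minus\<close> is the nondecreasing and \<open>H_plus\<close> the nonincreasing part.\<close>

definition H_minus ::
  "('n \<Rightarrow> real ^ 'd \<Rightarrow> real \<Rightarrow> real) \<Rightarrow> 'n \<Rightarrow> real ^ 'd \<Rightarrow> real \<Rightarrow> real" where
  "H_minus H i x p = (if p \<le> min_point H i x then H i x (min_point H i x) else H i x p)"

definition H_plus ::
  "('n \<Rightarrow> real ^ 'd \<Rightarrow> real \<Rightarrow> real) \<Rightarrow> 'n \<Rightarrow> real ^ 'd \<Rightarrow> real \<Rightarrow> real" where
  "H_plus H i x p = (if p \<le> min_point H i x then H i x p else H i x (min_point H i x))"

text \<open>
  \<open>G v lam \<nu> K\<close> is the operator of the equation with Hamiltonian \<open>K\<close>, where \<open>K\<close> is \<open>H\<close>,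
  \<open>H_minus H\<close> or \<open>H_plus H\<close>.
\<close>

definition G ::
  "('n::finite \<Rightarrow> real ^ 'd) \<Rightarrow> real \<Rightarrow> ('n \<Rightarrow> 'n \<Rightarrow> real ^ 'd \<Rightarrow> real \<Rightarrow> real) \<Rightarrow>
   ('n \<Rightarrow> real ^ 'd \<Rightarrow> real \<Rightarrow> real) \<Rightarrow> 'n \<Rightarrow> real \<Rightarrow>
   (real ^ 'd \<Rightarrow> real) \<Rightarrow> (real ^ 'd \<Rightarrow> real) \<Rightarrow> real \<Rightarrow> real ^ 'd \<Rightarrow> ereal" where
  "G v lam \<nu> K i \<delta> u \<phi> p x =
     ereal (lam * u x) - nonlocal v \<nu> i (jball_compl v \<delta> x) u x - nonlocal v \<nu> i (jball v \<delta> x) \<phi> x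
       + ereal (K i x p)"

text \<open>
  The minimum over \<open>p\<close> is written as an infimum. It is attained whenever the nonlocal terms at
  \<open>0\<close> are finite, since \<open>H_minus H i 0\<close> is bounded below and tends to \<open>\<infinity>\<close> at \<open>\<infinity>\<close>.
\<close>

definition FL_minus ::
  "('n::finite \<Rightarrow> real ^ 'd) \<Rightarrow> real \<Rightarrow> ('n \<Rightarrow> 'n \<Rightarrow> real ^ 'd \<Rightarrow> real \<Rightarrow> real) \<Rightarrow>
   ('n \<Rightarrow> real ^ 'd \<Rightarrow> real \<Rightarrow> real) \<Rightarrow> real \<Rightarrow> real \<Rightarrow>
   (real ^ 'd \<Rightarrow> real) \<Rightarrow> (real ^ 'd \<Rightarrow> real) \<Rightarrow> ereal" where
  "FL_minus v lam \<nu> H B \<delta> u \<phi> =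
     (INF p. max (MAX i. G v lam \<nu> (H_minus H) i \<delta> u \<phi> (p i) 0)
                 (ereal ((\<Sum>i\<in>UNIV. - p i) - B)))"


section \<open>Viscosity solutions\<close>

definition max_point_in :: "(real ^ 'd) set \<Rightarrow> (real ^ 'd \<Rightarrow> real) \<Rightarrow> real ^ 'd \<Rightarrow> bool" where
  "max_point_in S f x \<longleftrightarrow> x \<in> S \<and> (\<forall>y\<in>S. f y \<le> f x)"

definition min_point_in :: "(real ^ 'd) set \<Rightarrow> (real ^ 'd \<Rightarrow> real) \<Rightarrow> real ^ 'd \<Rightarrow> bool" where
  "min_point_in S f x \<longleftrightarrow> x \<in> S \<and> (\<forall>y\<in>S. f x \<le> f y)"

definition kirchhoff_subsolution ::
  "('n::finite \<Rightarrow> real ^ 'd) \<Rightarrow> real \<Rightarrow> ('n \<Rightarrow> 'n \<Rightarrow> real ^ 'd \<Rightarrow> real \<Rightarrow> real) \<Rightarrow>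
   ('n \<Rightarrow> real ^ 'd \<Rightarrow> real \<Rightarrow> real) \<Rightarrow> ('n \<Rightarrow> real) \<Rightarrow> real \<Rightarrow> (real ^ 'd \<Rightarrow> real) \<Rightarrow> bool" where
  "kirchhoff_subsolution v lam \<nu> H h B u \<longleftrightarrow>
     u \<in> USC v \<and>
     (\<forall>x\<in>junction v. \<forall>\<delta>>0. \<forall>\<phi>\<in>C1 v. max_point_in (jball v \<delta> x) (\<lambda>y. u y - \<phi> y) x \<longrightarrow>
        (\<forall>i. x \<in> edge v i \<longrightarrow> G v lam \<nu> H i \<delta> u \<phi> (edge_deriv v i \<phi> x) x \<le> 0) \<and>
        (x = 0 \<longrightarrow>
           min (MIN i. G v lam \<nu> H i \<delta> u \<phi> (edge_deriv v i \<phi> 0) 0)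
               (ereal ((\<Sum>i\<in>UNIV. - edge_deriv v i \<phi> 0) - B)) \<le> 0) \<and>
        (\<forall>i. x = v i \<longrightarrow>
           min (G v lam \<nu> H i \<delta> u \<phi> (edge_deriv v i \<phi> x) x) (ereal (u x - h i)) \<le> 0))"

definition kirchhoff_supersolution ::
  "('n::finite \<Rightarrow> real ^ 'd) \<Rightarrow> real \<Rightarrow> ('n \<Rightarrow> 'n \<Rightarrow> real ^ 'd \<Rightarrow> real \<Rightarrow> real) \<Rightarrow>
   ('n \<Rightarrow> real ^ 'd \<Rightarrow> real \<Rightarrow> real) \<Rightarrow> ('n \<Rightarrow> real) \<Rightarrow> real \<Rightarrow> (real ^ 'd \<Rightarrow> real) \<Rightarrow> bool" where
  "kirchhoff_supersolution v lam \<nu> H h B u \<longleftrightarrow>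
     u \<in> LSC v \<and>
     (\<forall>x\<in>junction v. \<forall>\<delta>>0. \<forall>\<phi>\<in>C1 v. min_point_in (jball v \<delta> x) (\<lambda>y. u y - \<phi> y) x \<longrightarrow>
        (\<forall>i. x \<in> edge v i \<longrightarrow> G v lam \<nu> H i \<delta> u \<phi> (edge_deriv v i \<phi> x) x \<ge> 0) \<and>
        (x = 0 \<longrightarrow>
           max (MAX i. G v lam \<nu> H i \<delta> u \<phi> (edge_deriv v i \<phi> 0) 0)
               (ereal ((\<Sum>i\<in>UNIV. - edge_deriv v i \<phi> 0) - B)) \<ge> 0) \<and>
        (\<forall>i. x = v i \<longrightarrow>
           max (G v lam \<nu> H i \<delta> u \<phi> (edge_deriv v i \<phi> x) x) (ereal (u x - h i)) \<ge> 0))"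

definition FL_subsolution ::
  "('n::finite \<Rightarrow> real ^ 'd) \<Rightarrow> real \<Rightarrow> ('n \<Rightarrow> 'n \<Rightarrow> real ^ 'd \<Rightarrow> real \<Rightarrow> real) \<Rightarrow>
   ('n \<Rightarrow> real ^ 'd \<Rightarrow> real \<Rightarrow> real) \<Rightarrow> ('n \<Rightarrow> real) \<Rightarrow> real \<Rightarrow> (real ^ 'd \<Rightarrow> real) \<Rightarrow> bool" where
  "FL_subsolution v lam \<nu> H h B u \<longleftrightarrow>
     u \<in> USC v \<and>
     (\<forall>x\<in>junction v. \<forall>\<delta>>0. \<forall>\<phi>\<in>C1 v. max_point_in (jball v \<delta> x) (\<lambda>y. u y - \<phi> y) x \<longrightarrow>
        (\<forall>i. x \<in> edge v i \<longrightarrow> G v lam \<nu> H i \<delta> u \<phi> (edge_deriv v i \<phi> x) x \<le> 0) \<and>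
        (x = 0 \<longrightarrow>
           max (MAX i. G v lam \<nu> (H_plus H) i \<delta> u \<phi> (edge_deriv v i \<phi> 0) 0)
               (FL_minus v lam \<nu> H B \<delta> u \<phi>) \<le> 0) \<and>
        (\<forall>i. x = v i \<longrightarrow>
           min (G v lam \<nu> H i \<delta> u \<phi> (edge_deriv v i \<phi> x) x) (ereal (u x - h i)) \<le> 0))"

definition FL_supersolution ::
  "('n::finite \<Rightarrow> real ^ 'd) \<Rightarrow> real \<Rightarrow> ('n \<Rightarrow> 'n \<Rightarrow> real ^ 'd \<Rightarrow> real \<Rightarrow> real) \<Rightarrow>
   ('n \<Rightarrow> real ^ 'd \<Rightarrow> real \<Rightarrow> real) \<Rightarrow> ('n \<Rightarrow> real) \<Rightarrow> real \<Rightarrow> (real ^ 'd \<Rightarrow> real) \<Rightarrow> bool" where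
  "FL_supersolution v lam \<nu> H h B u \<longleftrightarrow>
     u \<in> LSC v \<and>
     (\<forall>x\<in>junction v. \<forall>\<delta>>0. \<forall>\<phi>\<in>C1 v. min_point_in (jball v \<delta> x) (\<lambda>y. u y - \<phi> y) x \<longrightarrow>
        (\<forall>i. x \<in> edge v i \<longrightarrow> G v lam \<nu> H i \<delta> u \<phi> (edge_deriv v i \<phi> x) x \<ge> 0) \<and>
        (x = 0 \<longrightarrow>
           max (MAX i. G v lam \<nu> (H_plus H) i \<delta> u \<phi> (edge_deriv v i \<phi> 0) 0)
               (FL_minus v lam \<nu> H B \<delta> u \<phi>) \<ge> 0) \<and>
        (\<forall>i. x = v i \<longrightarrow>
           max (G v lam \<nu> H i \<delta> u \<phi> (edge_deriv v i \<phi> x) x) (ereal (u x - h i)) \<ge> 0))"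

end

theory Submission
  imports Defs
begin

text \<open>
  Only the condition at the vertex differs between the two notions. Let \<open>p\<close> be the tuple of slopes
  of the test function at \<open>0\<close>. For supersolutions, use \<open>p\<close> itself as a competitor in the flux
  limiter, together with \<open>H_plus \<le> H\<close> and \<open>H_minus \<le> H\<close>. For subsolutions, if the Kirchhoff
  condition fails, then \<open>H_plus < H\<close> at every \<open>p i\<close>, so \<open>H = H_minus\<close> there. Any competitor \<open>q\<close>
  has either \<open>q i \<ge> p i\<close> for some \<open>i\<close>, and the corresponding Hamiltonian term is no smaller than
  at \<open>p i\<close>, or \<open>q \<le> p\<close>, and the flux term is no smaller than at \<open>p\<close>. The flux limiter is
  therefore positive.
\<close>

text \<open>The open edge omits its end points, so \<open>0\<close> is reached as the limit
  \<open>t = 0\<close>. This puts the vertex in the set on which the assumptions on each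
  \<open>H i\<close> are stated.\<close>

lemma zero_in_closure_edge: "0 \<in> closure (edge v i)"
proof -
  have "edge v i = (\<lambda>t. t *\<^sub>R v i) ` {0<..<1}"
    by (auto simp: edge_def)
  moreover have "(\<lambda>t. t *\<^sub>R v i) ` closure {0<..<1::real} \<subseteq> closure ((\<lambda>t. t *\<^sub>R v i) ` {0<..<1})"
    by (intro image_closure_subset continuous_intros closure_subset) auto
  ultimately show ?thesis
    by force
qed

text \<open>As \<open>p\<close> lies between \<open>m\<close> and \<open>q\<close>, convexity bounds
  \<open>f p\<close> by a weighted mean of \<open>f m\<close> and \<open>f q\<close>, and
  \<open>f m\<close> is at most \<open>f q\<close>.\<close>

lemma convex_mono_right_of_min:
  fixes f :: "real \<Rightarrow> real"
  assumes "convex_on UNIV f" "is_min_point f m" "m \<le> p" "p \<le> q"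
  shows "f p \<le> f q"
proof -
  have "p \<in> closed_segment m q"
    using assms(3,4) by (auto simp: closed_segment_eq_real_ivl)
  then obtain t where t: "0 \<le> t" "t \<le> 1" "p = (1 - t) *\<^sub>R m + t *\<^sub>R q"
    by (auto simp: in_segment)
  have "f p \<le> (1 - t) * f m + t * f q"
    using convex_onD[OF assms(1), of t m q] t by simp
  also have "\<dots> \<le> (1 - t) * f q + t * f q"
    using assms(2) t(2) by (intro add_right_mono mult_left_mono) (auto simp: is_min_point_def)
  finally show ?thesis
    by (simp add: algebra_simps)
qed

lemma is_min_point_min_point:
  assumes "hamiltonians v H" "x \<in> closure (edge v i)"
  shows "is_min_point (H i x) (min_point H i x)"
proof -
  have "\<exists>!p. is_min_point (H i x) p"
    using assms by (auto simp: hamiltonians_def)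
  then show ?thesis
    unfolding min_point_def by (rule theI')
qed

lemma H_minus_le:
  assumes "hamiltonians v H" "x \<in> closure (edge v i)"
  shows "H_minus H i x p \<le> H i x p"
  using is_min_point_min_point[OF assms] by (simp add: H_minus_def is_min_point_def)

lemma H_plus_le:
  assumes "hamiltonians v H" "x \<in> closure (edge v i)"
  shows "H_plus H i x p \<le> H i x p"
  using is_min_point_min_point[OF assms] by (simp add: H_plus_def is_min_point_def)

lemma H_minus_mono:
  assumes "hamiltonians v H" "x \<in> closure (edge v i)" "p \<le> q"
  shows "H_minus H i x p \<le> H_minus H i x q"
proof -
  have "convex_on UNIV (H i x)"
    using assms(1,2) by (auto simp: hamiltonians_def)
  note mono = convex_mono_right_of_min[OF this is_min_point_min_point[OF assms(1,2)]]
  \<comment> \<open>The second instance of \<open>mono\<close> covers the case where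
    \<open>p\<close> and \<open>q\<close> lie on different sides of the minimum point.\<close>
  show ?thesis
    using assms(3) mono[of p q] mono[of "min_point H i x" q] by (auto simp: H_minus_def)
qed

text \<open>The Hamiltonian enters only as the last summand, and addition of extended reals is
  monotone even if the nonlocal terms are infinite.\<close>

lemma G_mono:
  assumes "K i x p \<le> K' i x q"
  shows "G v lam \<nu> K i \<delta> u \<phi> p x \<le> G v lam \<nu> K' i \<delta> u \<phi> q x"
  unfolding G_def using assms by (intro add_left_mono) simp

lemma kirchhoff_subsolution_at_vertex:
  assumes H: "hamiltonians v H"
    and FL: "max (MAX i. G v lam \<nu> (H_plus H) i \<delta> u \<phi> (p i) 0) (FL_minus v lam \<nu> H B \<delta> u \<phi>) \<le> 0"
  shows "min (MIN i. G v lam \<nu> H i \<delta> u \<phi> (p i) 0) (ereal ((\<Sum>i\<in>UNIV. - p i) - B)) \<le> 0"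
    (is "min ?m ?s \<le> 0")
proof (rule ccontr)
  assume "\<not> min ?m ?s \<le> 0"
  then have pos: "0 < min ?m ?s"
    by (simp only: not_le)
  have plus: "G v lam \<nu> (H_plus H) i \<delta> u \<phi> (p i) 0 \<le> 0" for i
    using FL by (simp add: Max_le_iff)
  have m_le: "?m \<le> G v lam \<nu> H i \<delta> u \<phi> (p i) 0" for i
    by (rule Min_le) auto
  have H_eq: "H_minus H i 0 (p i) = H i 0 (p i)" for i
  proof -
    have "0 < G v lam \<nu> H i \<delta> u \<phi> (p i) 0"
      using pos m_le[of i] by auto
    \<comment> \<open>Equality would make the two values of \<open>G\<close> coincide, although one
      is positive and the other is not. Hence \<open>p i\<close> lies strictly to the right of the
      minimum point.\<close>
    then have "H_plus H i 0 (p i) \<noteq> H i 0 (p i)"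
      using plus[of i] by (auto simp: G_def)
    then show ?thesis
      by (auto simp: H_plus_def H_minus_def split: if_splits)
  qed
  \<comment> \<open>The lower bound is uniform in the competitor \<open>q\<close>: an infimum of
    values that are merely positive could still be 0.\<close>
  have "min ?m ?s \<le> FL_minus v lam \<nu> H B \<delta> u \<phi>"
    unfolding FL_minus_def
  proof (rule INF_greatest)
    fix q :: "'a \<Rightarrow> real"
    let ?M = "MAX i. G v lam \<nu> (H_minus H) i \<delta> u \<phi> (q i) 0"
    show "min ?m ?s \<le> max ?M (ereal ((\<Sum>i\<in>UNIV. - q i) - B))"
    proof (cases "\<exists>i. p i \<le> q i")
      case True
      then obtain i where "p i \<le> q i" ..
      then have "H i 0 (p i) \<le> H_minus H i 0 (q i)"
        using H_minus_mono[OF H zero_in_closure_edge] H_eq by metis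
      then have "G v lam \<nu> H i \<delta> u \<phi> (p i) 0 \<le> G v lam \<nu> (H_minus H) i \<delta> u \<phi> (q i) 0"
        by (rule G_mono)
      also have "\<dots> \<le> ?M"
        by (rule Max_ge) auto
      finally show ?thesis
        using m_le[of i] by (meson max.coboundedI1 min.coboundedI1 order_trans)
    next
      case False
      then have "(\<Sum>i\<in>UNIV. - p i) \<le> (\<Sum>i\<in>UNIV. - q i)"
        by (intro sum_mono) (simp add: less_imp_le not_le)
      then show ?thesis
        by (intro max.coboundedI2 min.coboundedI2) simp
    qed
  qed
  also have "\<dots> \<le> 0"
    using FL by (rule max.boundedE)
  finally show False
    using pos by (meson leD)
qed

lemma kirchhoff_supersolution_at_vertex:
  assumes H: "hamiltonians v H"
    and FL: "max (MAX i. G v lam \<nu> (H_plus H) i \<delta> u \<phi> (p i) 0) (FL_minus v lam \<nu> H B \<delta> u \<phi>) \<ge> 0"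
  shows "max (MAX i. G v lam \<nu> H i \<delta> u \<phi> (p i) 0) (ereal ((\<Sum>i\<in>UNIV. - p i) - B)) \<ge> 0"
    (is "max ?M ?s \<ge> 0")
proof -
  \<comment> \<open>\<open>K\<close> is kept general to serve for both \<open>H_minus H\<close> and
    \<open>H_plus H\<close>.\<close>
  have Max_mono: "(MAX i. G v lam \<nu> K i \<delta> u \<phi> (p i) 0) \<le> ?M"
    if "\<And>i. K i 0 (p i) \<le> H i 0 (p i)" for K
  proof (rule Max.boundedI)
    fix a
    assume "a \<in> range (\<lambda>i. G v lam \<nu> K i \<delta> u \<phi> (p i) 0)"
    then obtain i where "a = G v lam \<nu> K i \<delta> u \<phi> (p i) 0" ..
    also have "\<dots> \<le> G v lam \<nu> H i \<delta> u \<phi> (p i) 0"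
      by (intro G_mono that)
    also have "\<dots> \<le> ?M"
      by (rule Max_ge) auto
    finally show "a \<le> ?M" .
  qed auto
  have "FL_minus v lam \<nu> H B \<delta> u \<phi> \<le> max (MAX i. G v lam \<nu> (H_minus H) i \<delta> u \<phi> (p i) 0) ?s"
    unfolding FL_minus_def by (rule INF_lower) simp
  also have "\<dots> \<le> max ?M ?s"
    by (intro max.mono order_refl Max_mono H_minus_le[OF H zero_in_closure_edge])
  finally have "FL_minus v lam \<nu> H B \<delta> u \<phi> \<le> max ?M ?s" .
  moreover have "(MAX i. G v lam \<nu> (H_plus H) i \<delta> u \<phi> (p i) 0) \<le> max ?M ?s"
    by (intro max.coboundedI1 Max_mono H_plus_le[OF H zero_in_closure_edge])
  ultimately show ?thesis
    using FL by (meson max.boundedI order_trans)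
qed

theorem theorem8p5:
  fixes v :: "'n::finite \<Rightarrow> real ^ 'd"
    and lam B :: real
    and \<nu> :: "'n \<Rightarrow> 'n \<Rightarrow> real ^ 'd \<Rightarrow> real \<Rightarrow> real"
    and H :: "'n \<Rightarrow> real ^ 'd \<Rightarrow> real \<Rightarrow> real"
    and h :: "'n \<Rightarrow> real"
  assumes "is_junction v"
    and "lam > 0"
    and "hamiltonians v H"
    and "kernels v \<nu>"
  shows "(\<forall>u. FL_subsolution v lam \<nu> H h B u \<longrightarrow> kirchhoff_subsolution v lam \<nu> H h B u) \<and>
         (\<forall>u. FL_supersolution v lam \<nu> H h B u \<longrightarrow> kirchhoff_supersolution v lam \<nu> H h B u)"
proof (intro conjI allI impI)
  fix u
  assume "FL_subsolution v lam \<nu> H h B u"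
  then show "kirchhoff_subsolution v lam \<nu> H h B u"
    unfolding FL_subsolution_def kirchhoff_subsolution_def
    \<comment> \<open>The slopes are fixed as a function of a schematic \<open>\<phi>\<close>, since
      the test function is bound inside the definitions.\<close>
    using kirchhoff_subsolution_at_vertex[OF assms(3), where p = "\<lambda>i. edge_deriv v i \<phi> 0" for \<phi>]
    by blast
next
  fix u
  assume "FL_supersolution v lam \<nu> H h B u"
  then show "kirchhoff_supersolution v lam \<nu> H h B u"
    unfolding FL_supersolution_def kirchhoff_supersolution_def
    using kirchhoff_supersolution_at_vertex[OF assms(3), where p = "\<lambda>i. edge_deriv v i \<phi> 0" for \<phi>]
    by blast
qed

end
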